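(* Let $G=(V,E)$ be a directed or undirected graph with positive edge lengths $w$, let $U\subseteq V$ be the set of rankee nodes, and let $s$ be a source node. Run the reverse-rank single-source algorithm (described in the context) from $s$, where the function $\hat n_v(d)$ used in it is either (i) the exact cardinality $\hat n_v(d)=n_v(d)$ for all $v,d$, or (ii) the bottom-$k$ estimate of $n_v(d)$ for all $v,d$. Then the algorithm traverses a shortest-paths tree from $s$ in the transposed graph $G^T$: whenever a node $v$ is extracted from the queue, $v.\mathrm{dist}$ equals the shortest-path distance $d_{vs}$ from $v$ to $s$ in $G$, and the edges through which the extracted nodes obtained their final values of $\mathrm{dist}$ form a tree of shortest paths to $s$ that contains every node that can reach $s$.
   Context: For nodes $i,j$, $d_{ij}$ is the shortest-path distance from $i$ to $j$ in $G$; $G^T$ is $G$ with edges reversed. For $y\ge 0$, $N_i(y)=\{j\in U: d_{ij}\le y\}$ and $n_i(y)=|N_i(y)|$. Bottom-$k$ estimates: fix an integer $k\geq 1$ and values $r:U\to(0,1]$ (distinct, coming from a random permutation of $U$ or i.i.d. uniform). The bottom-$k$ estimate of $n_i(y)$ is $|N_i(y)|$ if $|N_i(y)|<k$, and otherwise $(k-1)/\tau$ where $\tau$ is the $k$-th smallest $r$ value among nodes of $N_i(y)$. These estimates are available to the algorithm (from precomputed lists) for any node and distance. Reverse-rank single-source algorithm from $s$. Maintain a min priority queue $Q$ of nodes; each queued node $v$ carries two numbers $v.\mathrm{rDr}$ and $v.\mathrm{dist}$, and the priority is the lexicographic order of $(v.\mathrm{rDr},v.\mathrm{dist})$, with remaining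 ties broken arbitrarily. Initially $Q$ contains only $s$ with $s.\mathrm{rDr}=1$, $s.\mathrm{dist}=0$. While $Q$ is nonempty: extract a minimum-priority node $v$, output it, and mark it scanned; then for each edge $(u,v)\in E$ with $u$ not scanned, put $d= v.\mathrm{dist}+w(u,v)$; if $u\notin Q$, insert $u$ with $u.\mathrm{dist}=d$ and $u.\mathrm{rDr}=\hat n_u(d)$; if $u\in Q$ and $d<u.\mathrm{dist}$, update $u.\mathrm{dist}\leftarrow d$ and $u.\mathrm{rDr}\leftarrow\hat n_u(d)$. *)

theory Defs
  imports "Graph_Theory.Pair_Digraph" "Graph_Theory.Digraph_Component" "Graph_Theory.Shortest_Path"
begin

section \<open>Graphs with edge lengths\<close>

definition directed_network :: "'a pair_pre_digraph \<Rightarrow> ('a \<times> 'a \<Rightarrow> real) \<Rightarrow> bool" where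
  "directed_network G w \<longleftrightarrow> pair_fin_digraph G \<and> (\<forall>e\<in>parcs G. 0 < w e)"

text \<open>As in Graph_Theory, an undirected graph is a symmetric digraph: an undirected edge
  \<open>{u, v}\<close> is the pair of arcs \<open>(u, v)\<close>, \<open>(v, u)\<close>, here of the same length.\<close>

definition undirected_network :: "'a pair_pre_digraph \<Rightarrow> ('a \<times> 'a \<Rightarrow> real) \<Rightarrow> bool" where
  "undirected_network G w \<longleftrightarrow> pair_pseudo_graph G \<and> (\<forall>e\<in>parcs G. 0 < w e)
     \<and> (\<forall>(u, v)\<in>parcs G. w (u, v) = w (v, u))"

text \<open>The distance takes the value \<open>\<infinity>\<close> when there is no path.\<close>

abbreviation distance :: "'a pair_pre_digraph \<Rightarrow> ('a \<times> 'a \<Rightarrow> real) \<Rightarrow> 'a \<Rightarrow> 'a \<Rightarrow> ereal" where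
  "distance G w u v \<equiv> wf_digraph.\<mu> (with_proj G) w u v"

definition reverse_arcs :: "'a pair_pre_digraph \<Rightarrow> 'a pair_pre_digraph" where
  "reverse_arcs G = \<lparr> pverts = pverts G, parcs = (parcs G)\<inverse> \<rparr>"

definition reverse_lengths :: "('a \<times> 'a \<Rightarrow> real) \<Rightarrow> ('a \<times> 'a \<Rightarrow> real)" where
  "reverse_lengths w = (\<lambda>(u, v). w (v, u))"

text \<open>A shortest-paths tree \<open>T\<close> from \<open>s\<close> in \<open>G\<close>: a subgraph that is a tree directed away from
  its root \<open>s\<close> (exactly one walk from \<open>s\<close> to each of its nodes) and whose tree paths are
  shortest paths of \<open>G\<close>. The predicate \<open>tree\<close> of Graph_Theory only excludes directed cycles,
  so it is not the right notion for a directed tree. \<open>T\<close> need not be spanning here.\<close>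

definition shortest_paths_tree ::
    "'a pair_pre_digraph \<Rightarrow> ('a \<times> 'a \<Rightarrow> real) \<Rightarrow> 'a \<Rightarrow> 'a pair_pre_digraph \<Rightarrow> bool" where
  "shortest_paths_tree G w s T \<longleftrightarrow>
     subgraph (with_proj T) (with_proj G) \<and> s \<in> pverts T \<and>
     (\<forall>v\<in>pverts T. \<exists>!p. pre_digraph.awalk (with_proj T) s p v) \<and>
     (\<forall>v\<in>pverts T. \<forall>p. pre_digraph.awalk (with_proj T) s p v \<longrightarrow>
        ereal (wf_digraph.awalk_cost w p) = distance G w s v)"

section \<open>Neighborhood cardinalities and their bottom-k estimates\<close>

definition neighborhood ::
    "'a pair_pre_digraph \<Rightarrow> ('a \<times> 'a \<Rightarrow> real) \<Rightarrow> 'a set \<Rightarrow> 'a \<Rightarrow> real \<Rightarrow> 'a set" where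
  "neighborhood G w U i y = {j \<in> U. distance G w i j \<le> ereal y}"

definition exact_count ::
    "'a pair_pre_digraph \<Rightarrow> ('a \<times> 'a \<Rightarrow> real) \<Rightarrow> 'a set \<Rightarrow> 'a \<Rightarrow> real \<Rightarrow> real" where
  "exact_count G w U i y = real (card (neighborhood G w U i y))"

definition kth_smallest :: "nat \<Rightarrow> real set \<Rightarrow> real" where
  "kth_smallest k A = sorted_list_of_set A ! (k - 1)"

definition bottom_k_estimate ::
    "'a pair_pre_digraph \<Rightarrow> ('a \<times> 'a \<Rightarrow> real) \<Rightarrow> 'a set \<Rightarrow> nat \<Rightarrow> ('a \<Rightarrow> real) \<Rightarrow> 'a \<Rightarrow> real \<Rightarrow> real"
  where
  "bottom_k_estimate G w U k r i y =
     (let N = neighborhood G w U i y in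
      if card N < k then real (card N)
      else (real k - 1) / kth_smallest k (r ` N))"

section \<open>The reverse-rank single-source algorithm\<close>

text \<open>\<open>node_dist\<close> and \<open>node_rDr\<close> are meaningful only for nodes that have been queued. Scanned
  nodes are listed in the order of extraction. \<open>via\<close> does not influence the search; it records
  the edge through which a node received its current value of \<open>node_dist\<close>.\<close>

record 'a search_state =
  queue :: "'a set"
  node_rDr :: "'a \<Rightarrow> real"
  node_dist :: "'a \<Rightarrow> real"
  via :: "'a \<Rightarrow> ('a \<times> 'a) option"
  scanned :: "'a list"

definition initial_state :: "'a \<Rightarrow> 'a search_state" where
  "initial_state s =
     \<lparr> queue = {s}, node_rDr = (\<lambda>_. undefined)(s := 1), node_dist = (\<lambda>_. undefined)(s := 0),
       via = (\<lambda>_. None), scanned = [] \<rparr>"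

definition precedes :: "'a search_state \<Rightarrow> 'a \<Rightarrow> 'a \<Rightarrow> bool" where
  "precedes S u v \<longleftrightarrow> node_rDr S u < node_rDr S v
     \<or> node_rDr S u = node_rDr S v \<and> node_dist S u < node_dist S v"

definition relax ::
    "('a \<times> 'a \<Rightarrow> real) \<Rightarrow> ('a \<Rightarrow> real \<Rightarrow> real) \<Rightarrow> 'a \<times> 'a \<Rightarrow> 'a search_state \<Rightarrow> 'a search_state" where
  "relax w nhat e S =
     (let u = fst e; v = snd e; d = node_dist S v + w e in
      if u \<notin> set (scanned S) \<and> (u \<notin> queue S \<or> d < node_dist S u)
      then S\<lparr> queue := insert u (queue S),
              node_rDr := (node_rDr S)(u := nhat u d),
              node_dist := (node_dist S)(u := d),
              via := (via S)(u := Some e) \<rparr>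
      else S)"

text \<open>One iteration of the loop, extracting \<open>v\<close>. Ties among the nodes of minimum priority, and
  the order \<open>es\<close> in which the edges into \<open>v\<close> are processed, are left nondeterministic.\<close>

definition iteration ::
    "'a pair_pre_digraph \<Rightarrow> ('a \<times> 'a \<Rightarrow> real) \<Rightarrow> ('a \<Rightarrow> real \<Rightarrow> real) \<Rightarrow>
     'a \<Rightarrow> 'a search_state \<Rightarrow> 'a search_state \<Rightarrow> bool" where
  "iteration G w nhat v S S' \<longleftrightarrow>
     v \<in> queue S \<and> (\<forall>u\<in>queue S. \<not> precedes S u v) \<and>
     (\<exists>es. distinct es \<and> set es = in_arcs (with_proj G) v \<and>
        S' = fold (relax w nhat) es
               (S\<lparr> queue := queue S - {v}, scanned := scanned S @ [v] \<rparr>))"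

text \<open>A run is the sequence of states at the head of the loop; after the queue has become empty
  the last state is repeated.\<close>

definition run ::
    "'a pair_pre_digraph \<Rightarrow> ('a \<times> 'a \<Rightarrow> real) \<Rightarrow> ('a \<Rightarrow> real \<Rightarrow> real) \<Rightarrow> 'a \<Rightarrow>
     (nat \<Rightarrow> 'a search_state) \<Rightarrow> bool" where
  "run G w nhat s f \<longleftrightarrow> f 0 = initial_state s \<and>
     (\<forall>i. if queue (f i) = {} then f (Suc i) = f i
          else \<exists>v. iteration G w nhat v (f i) (f (Suc i)))"

text \<open>The edges keep their direction in \<open>G\<close>, i.e. they point towards the source.\<close>

definition search_tree :: "'a search_state \<Rightarrow> 'a pair_pre_digraph" where
  "search_tree S = \<lparr> pverts = set (scanned S),
     parcs = {e. \<exists>v\<in>set (scanned S). via S v = Some e} \<rparr>"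

subsection \<open>Runs exist\<close>

lemma finite_queue_fold_relax:
  "finite (queue S) \<Longrightarrow> finite (queue (fold (relax w nhat) es S))"
  by (induction es arbitrary: S) (auto simp: relax_def Let_def)

lemma iteration_finite_queue:
  "iteration G w nhat v S S' \<Longrightarrow> finite (queue S) \<Longrightarrow> finite (queue S')"
  by (auto simp: iteration_def intro!: finite_queue_fold_relax)

lemma iteration_exists:
  assumes "pair_fin_digraph G" "finite (queue S)" "queue S \<noteq> {}"
  shows "\<exists>v S'. iteration G w nhat v S S'"
proof -
  define m where "m = Min (node_rDr S ` queue S)"
  define M where "M = {u \<in> queue S. node_rDr S u = m}"
  have "m \<in> node_rDr S ` queue S" unfolding m_def using assms by (intro Min_in) auto
  then have M: "M \<noteq> {}" "finite M" using assms by (auto simp: M_def)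
  define v where "v = arg_min_on (node_dist S) M"
  have v: "v \<in> M" "\<And>u. u \<in> M \<Longrightarrow> node_dist S v \<le> node_dist S u"
    using arg_min_if_finite[of M "node_dist S"] M by (auto simp: v_def not_less)
  have "\<not> precedes S u v" if "u \<in> queue S" for u
  proof -
    have "m \<le> node_rDr S u" unfolding m_def using assms that by (intro Min_le) auto
    then show ?thesis using v that by (force simp: precedes_def M_def)
  qed
  moreover have "finite (in_arcs (with_proj G) v)"
    using assms(1) pair_fin_digraph.pair_finite_arcs[of G] by (simp add: in_arcs_def)
  then obtain es where "distinct es" "set es = in_arcs (with_proj G) v"
    using finite_distinct_list by metis
  ultimately show ?thesis using v(1) unfolding iteration_def M_def by blast
qed

lemma run_exists:
  assumes "pair_fin_digraph G"
  shows "\<exists>f. run G w nhat s f"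
proof -
  let ?Q = "\<lambda>S S'. if queue S = {} then S' = S else \<exists>v. iteration G w nhat v S S'"
  have "\<exists>f. \<forall>n. (finite (queue (f n)) \<and> (n = 0 \<longrightarrow> f n = initial_state s)) \<and> ?Q (f n) (f (Suc n))"
  proof (rule dependent_nat_choice)
    show "\<exists>S. finite (queue S) \<and> (0 = (0::nat) \<longrightarrow> S = initial_state s)"
      by (auto simp: initial_state_def)
  next
    fix S :: "'a search_state" and n :: nat
    assume S: "finite (queue S) \<and> (n = 0 \<longrightarrow> S = initial_state s)"
    show "\<exists>S'. (finite (queue S') \<and> (Suc n = 0 \<longrightarrow> S' = initial_state s)) \<and> ?Q S S'"
    proof (cases "queue S = {}")
      case True
      then show ?thesis by (intro exI[of _ S]) simp
    next
      case False
      then obtain v S' where "iteration G w nhat v S S'"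
        using iteration_exists[OF assms, of S] S by blast
      then show ?thesis using False S iteration_finite_queue[of G w nhat v S S'] by auto
    qed
  qed
  then show ?thesis unfolding run_def by blast
qed

end

theory Submission
  imports Defs
begin

text \<open>
  Passing from a node \<open>v\<close> to a predecessor \<open>u\<close> on a walk to \<open>s\<close> can only enlarge the
  neighborhood that is counted: the one of \<open>u\<close> with radius \<open>d + w (u, v)\<close> contains the one of
  \<open>v\<close> with radius \<open>d\<close>. Exact cardinalities and bottom-k estimates are monotone under inclusion,
  so the priority never decreases along a walk away from \<open>s\<close>. The exchange argument for
  Dijkstra's algorithm therefore applies: if \<open>v\<close> were extracted with a value exceeding the length
  of a walk from \<open>v\<close> to \<open>s\<close>, then the last unscanned node on that walk would be queued with a
  strictly smaller priority.
\<close>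

section \<open>Monotonicity of the neighborhood estimates\<close>

text \<open>Trades a position in the sorted list for a count of elements below a threshold. The
  count is visibly monotone in the set, which the position is not.\<close>

lemma kth_smallest_le_iff:
  fixes A :: "real set"
  assumes "finite A" "1 \<le> k" "k \<le> card A"
  shows "kth_smallest k A \<le> t \<longleftrightarrow> k \<le> card {a\<in>A. a \<le> t}"
proof -
  define xs where "xs = sorted_list_of_set A"
  have len: "length xs = card A" and set: "set xs = A" and srt: "sorted xs" and dst: "distinct xs"
    using assms(1) by (simp_all add: xs_def)
  show ?thesis
  proof
    assume le: "kth_smallest k A \<le> t"
    have "xs ! i \<le> t" if "i < k" for i
    proof -
      have "xs ! i \<le> xs ! (k - 1)" using that assms len by (intro sorted_nth_mono[OF srt]) auto
      then show ?thesis using le by (simp add: kth_smallest_def xs_def)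
    qed
    then have "(!) xs ` {..<k} \<subseteq> {a\<in>A. a \<le> t}"
      using assms(3) len set by (auto intro: nth_mem)
    then have "card ((!) xs ` {..<k}) \<le> card {a\<in>A. a \<le> t}"
      using assms(1) by (intro card_mono) auto
    moreover have "inj_on ((!) xs) {..<k}"
      using assms(3) len dst by (intro inj_on_nth) auto
    ultimately show "k \<le> card {a\<in>A. a \<le> t}" by (simp add: card_image)
  next
    assume le: "k \<le> card {a\<in>A. a \<le> t}"
    show "kth_smallest k A \<le> t"
    proof (rule ccontr)
      assume gt: "\<not> kth_smallest k A \<le> t"
      \<comment> \<open>Entries at position \<open>k - 1\<close> or later exceed \<open>t\<close>,
        so only \<open>k - 1\<close> positions remain for elements below \<open>t\<close>.\<close>
      have "{a\<in>A. a \<le> t} \<subseteq> (!) xs ` {..<k - 1}"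
      proof
        fix a assume a: "a \<in> {a\<in>A. a \<le> t}"
        then obtain i where i: "i < length xs" "xs ! i = a"
          using set by (auto simp: in_set_conv_nth)
        have "i < k - 1"
        proof (rule ccontr)
          assume "\<not> i < k - 1"
          then have "xs ! (k - 1) \<le> xs ! i"
            using sorted_nth_mono[OF srt, of "k - 1" i] i by simp
          then show False using gt a i by (simp add: kth_smallest_def xs_def)
        qed
        then show "a \<in> (!) xs ` {..<k - 1}" using i by auto
      qed
      then have "card {a\<in>A. a \<le> t} \<le> card ((!) xs ` {..<k - 1})" by (intro card_mono) auto
      also have "\<dots> \<le> k - 1" using card_image_le[of "{..<k - 1}" "(!) xs"] by simp
      finally show False using le assms(2) by simp
    qed
  qed
qed

text \<open>A larger set has at least as many elements below the threshold
  \<open>kth_smallest k A\<close>; the counting criterion then applies to \<open>B\<close>.\<close>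

lemma kth_smallest_antimono:
  assumes "finite B" "A \<subseteq> B" "1 \<le> k" "k \<le> card A"
  shows "kth_smallest k B \<le> kth_smallest k A"
proof -
  have fin: "finite A" and card: "card A \<le> card B"
    using assms finite_subset card_mono by auto
  have "k \<le> card {a\<in>A. a \<le> kth_smallest k A}"
    using kth_smallest_le_iff[OF fin assms(3,4)] by blast
  also have "\<dots> \<le> card {a\<in>B. a \<le> kth_smallest k A}"
    using assms by (intro card_mono) auto
  finally show ?thesis
    using kth_smallest_le_iff[OF assms(1,3), of "kth_smallest k A"] assms card by linarith
qed

lemma kth_smallest_in:
  assumes "finite A" "1 \<le> k" "k \<le> card A"
  shows "kth_smallest k A \<in> A"
proof -
  have "sorted_list_of_set A ! (k - 1) \<in> set (sorted_list_of_set A)"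
    using assms by (intro nth_mem) simp
  then show ?thesis using assms by (simp add: kth_smallest_def)
qed

lemma exact_count_mono:
  assumes "finite U" "neighborhood G w U i y \<subseteq> neighborhood G w U j z"
  shows "exact_count G w U i y \<le> exact_count G w U j z"
proof -
  have "finite (neighborhood G w U j z)" using assms(1) by (simp add: neighborhood_def)
  then show ?thesis using assms(2) by (simp add: exact_count_def card_mono)
qed

text \<open>The estimate switches formula when the cardinality reaches \<open>k\<close>, so the
  cases depend on which of the two sets has at least \<open>k\<close> elements. Within one formula
  the claim is monotonicity of \<open>card\<close> or antitonicity of
  \<open>kth_smallest\<close>.\<close>

lemma bottom_k_estimate_mono:
  assumes "finite U" "1 \<le> k" "inj_on r U" "r ` U \<subseteq> {0<..1}"
    and sub: "neighborhood G w U i y \<subseteq> neighborhood G w U j z"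
  shows "bottom_k_estimate G w U k r i y \<le> bottom_k_estimate G w U k r j z"
proof -
  define M N where "M = neighborhood G w U i y" and "N = neighborhood G w U j z"
  have MN: "M \<subseteq> N" "N \<subseteq> U" "finite N" "finite M"
    using assms(1) sub by (auto simp: M_def N_def neighborhood_def)
  have card: "card M \<le> card N" using MN by (simp add: card_mono)
  \<comment> \<open>Injectivity of \<open>r\<close> keeps at least \<open>k\<close> distinct values,
    so the \<open>k\<close>-th smallest is a genuine value of \<open>r\<close>, hence positive and
    at most 1.\<close>
  have ran: "kth_smallest k (r ` X) \<in> {0<..1} \<and> card (r ` X) = card X"
    if "X \<subseteq> N" "k \<le> card X" for X
  proof -
    have "card (r ` X) = card X"
      using that MN assms(3) by (meson card_image inj_on_subset subset_trans)
    moreover have "kth_smallest k (r ` X) \<in> r ` X"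
      using that MN assms(2) calculation by (intro kth_smallest_in) (auto intro: finite_subset)
    ultimately show ?thesis using assms(4) that MN by blast
  qed
  consider "card N < k" | "card M < k" "k \<le> card N" | "k \<le> card M" by linarith
  then have "(if card M < k then real (card M) else (real k - 1) / kth_smallest k (r ` M))
    \<le> (if card N < k then real (card N) else (real k - 1) / kth_smallest k (r ` N))"
  proof cases
    case 1
    then show ?thesis using card by simp
  next
    case 2
    \<comment> \<open>Across the switch, \<open>card M \<le> k - 1\<close>, and dividing
      \<open>k - 1\<close> by a number in \<open>(0, 1]\<close> does not decrease it.\<close>
    have "0 < kth_smallest k (r ` N)" "kth_smallest k (r ` N) \<le> 1" using ran[of N] 2 by auto
    then have "real k - 1 \<le> (real k - 1) / kth_smallest k (r ` N)"
      using assms(2) by (simp add: le_divide_eq mult_left_le)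
    then show ?thesis using 2 by simp
  next
    case 3
    then have "kth_smallest k (r ` N) \<le> kth_smallest k (r ` M)"
      using MN ran[of M] assms(2) by (intro kth_smallest_antimono) auto
    then show ?thesis
      using 3 card ran[of N] assms(2) by (auto intro!: divide_left_mono)
  qed
  then show ?thesis unfolding bottom_k_estimate_def Let_def M_def N_def .
qed

lemma neighborhood_mono: "y \<le> z \<Longrightarrow> neighborhood G w U i y \<subseteq> neighborhood G w U i z"
  by (auto simp: neighborhood_def intro: order_trans)

section \<open>Distances and reversal\<close>

context pair_fin_digraph
begin

text \<open>Prepend the arc to a cheapest walk from \<open>v\<close> to \<open>t\<close>; without
  such a walk the right-hand side is infinite.\<close>

lemma distance_arc:
  assumes "\<And>e. e \<in> parcs G \<Longrightarrow> 0 \<le> w e" "(u, v) \<in> parcs G"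
  shows "distance G w u t \<le> distance G w v t + ereal (w (u, v))"
proof (cases "reachable G v t")
  case True
  then obtain p where p: "awalk v p t" "distance G w v t = awalk_cost w p"
    using min_cost_awalk[of v t w] assms(1) by (auto simp: apath_def)
  then have "awalk u ((u, v) # p) t" using assms(2) by (simp add: awalk_Cons_iff)
  from min_cost_le_walk_cost[OF this, of w] show ?thesis using p by (simp add: add.commute)
next
  case False
  then show ?thesis by (simp add: shortest_path_inf)
qed

text \<open>The triangle inequality in terms of balls. With monotonicity of the estimate under
  inclusion it yields the locale assumption \<open>nhat_arc\<close>.\<close>

lemma neighborhood_arc:
  assumes "\<And>e. e \<in> parcs G \<Longrightarrow> 0 \<le> w e" "(u, v) \<in> parcs G"
  shows "neighborhood G w U v y \<subseteq> neighborhood G w U u (y + w (u, v))"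
proof
  fix j assume "j \<in> neighborhood G w U v y"
  then have "j \<in> U" "distance G w v j \<le> ereal y" by (auto simp: neighborhood_def)
  moreover have "distance G w u j \<le> distance G w v j + ereal (w (u, v))"
    using assms by (intro distance_arc)
  moreover have "distance G w v j + ereal (w (u, v)) \<le> ereal y + ereal (w (u, v))"
    using calculation(2) by (rule add_right_mono)
  ultimately show "j \<in> neighborhood G w U u (y + w (u, v))" by (auto simp: neighborhood_def)
qed

lemma distance_self:
  assumes "\<And>e. e \<in> parcs G \<Longrightarrow> 0 \<le> w e" "v \<in> pverts G"
  shows "distance G w v v = 0"
proof (rule antisym)
  have "awalk v [] v" using assms(2) by (simp add: awalk_Nil_iff)
  from min_cost_le_walk_cost[OF this, of w] show "distance G w v v \<le> 0" by (simp add: zero_ereal_def)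
  show "0 \<le> distance G w v v"
    unfolding \<mu>_def using pos_cost_pos_awalk_cost[of v _ v w] assms(1)
    by (auto intro!: INF_greatest)
qed

end

section \<open>Reversal of arcs and walks\<close>

lemma reverse_arcs_simps [simp]:
  "pverts (reverse_arcs G) = pverts G" "parcs (reverse_arcs G) = (parcs G)\<inverse>"
  by (simp_all add: reverse_arcs_def)

lemma reverse_arcs_reverse_arcs [simp]: "reverse_arcs (reverse_arcs G) = G"
  by (simp add: reverse_arcs_def)

context pair_wf_digraph
begin

lemma reverse_arcs_wf: "pair_wf_digraph (reverse_arcs G)"
  by unfold_locales (auto dest: arc_fst_in_verts arc_snd_in_verts)

lemma awalk_reverse_arcsI:
  assumes "awalk u p v"
  shows "pre_digraph.awalk (with_proj (reverse_arcs G)) v (rev_path p) u"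
proof -
  interpret R: pair_wf_digraph "reverse_arcs G" by (rule reverse_arcs_wf)
  show ?thesis using assms
  proof (induction p arbitrary: u)
    case Nil
    then show ?case by (auto simp: awalk_Nil_iff R.awalk_Nil_iff)
  next
    case (Cons e p)
    then have e: "e \<in> parcs G" "u = fst e" "awalk (snd e) p v" by (auto simp: awalk_Cons_iff)
    have "R.awalk (snd e) [(snd e, fst e)] u"
      using e by (auto simp: R.awalk_simps dest: arc_fst_in_verts)
    then show ?case using R.awalk_appendI Cons.IH[OF e(3)] by simp
  qed
qed

lemma awalk_cost_reverse_lengths:
  "awalk_cost (reverse_lengths w) (rev_path p) = awalk_cost w p"
  by (induction p) (auto simp: reverse_lengths_def)

end

text \<open>Reversal is an involution, so the converse is the preceding implication applied inside
  \<open>reverse_arcs G\<close>.\<close>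

lemma (in pair_wf_digraph) awalk_reverse_arcs_iff:
  "pre_digraph.awalk (with_proj (reverse_arcs G)) v p u \<longleftrightarrow> awalk u (rev_path p) v"
proof -
  interpret R: pair_wf_digraph "reverse_arcs G" by (rule reverse_arcs_wf)
  show ?thesis
    using awalk_reverse_arcsI[of u "rev_path p" v] R.awalk_reverse_arcsI[of v p u] by auto
qed

text \<open>\<open>rev_path\<close> maps the walks of one graph onto those of the other and
  preserves cost, so both distances are infima of the same costs.\<close>

lemma (in pair_wf_digraph) distance_reverse_arcs:
  "distance (reverse_arcs G) (reverse_lengths w) v u = distance G w u v"
proof -
  interpret R: pair_wf_digraph "reverse_arcs G" by (rule reverse_arcs_wf)
  have "{p. R.awalk v p u} = rev_path ` {p. awalk u p v}"
    by (auto simp: awalk_reverse_arcs_iff image_iff) (metis rev_path_rev_path)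
  then show ?thesis
    by (simp add: R.\<mu>_def \<mu>_def image_image awalk_cost_reverse_lengths)
qed

section \<open>The search with a monotone estimate\<close>

text \<open>Isolates what correctness requires of the estimate, so that exact counts and bottom-k
  estimates are treated together.\<close>

locale monotone_search = pair_fin_digraph G for G :: "'a pair_pre_digraph" +
  fixes w :: "'a \<times> 'a \<Rightarrow> real" and nhat :: "'a \<Rightarrow> real \<Rightarrow> real" and s :: 'a
  assumes w_pos: "e \<in> parcs G \<Longrightarrow> 0 < w e"
    and source: "s \<in> pverts G"
    and nhat_mono: "d \<le> d' \<Longrightarrow> nhat v d \<le> nhat v d'"
    and nhat_arc: "(u, v) \<in> parcs G \<Longrightarrow> nhat v d \<le> nhat u (d + w (u, v))"
begin

section \<open>Invariants of the search\<close>

lemma w_nonneg: "e \<in> parcs G \<Longrightarrow> 0 \<le> w e"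
  using w_pos less_imp_le by blast

text \<open>The part of the invariant that survives while the edges into an extracted node are still
  being processed. Requiring \<open>s\<close> to be scanned excludes the initial state, where the
  priority 1 of \<open>s\<close> need not equal \<open>nhat s 0\<close>; that state is treated
  separately throughout.\<close>

definition consistent :: "'a search_state \<Rightarrow> bool" where
  "consistent S \<longleftrightarrow>
     s \<in> set (scanned S) \<and> node_dist S s = 0 \<and> via S s = None \<and>
     distinct (scanned S) \<and> set (scanned S) \<union> queue S \<subseteq> pverts G \<and>
     set (scanned S) \<inter> queue S = {} \<and>
     (\<forall>u\<in>set (scanned S) \<union> queue S. u \<noteq> s \<longrightarrow>
        (\<exists>x\<in>set (scanned S). (u, x) \<in> parcs G \<and> via S u = Some (u, x) \<and>
           node_dist S u = node_dist S x + w (u, x))) \<and>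
     (\<forall>u\<in>queue S. node_rDr S u = nhat u (node_dist S u)) \<and>
     (\<forall>x\<in>set (scanned S). ereal (node_dist S x) = distance G w x s)"

definition relaxed :: "'a search_state \<Rightarrow> 'a \<times> 'a \<Rightarrow> bool" where
  "relaxed S e \<longleftrightarrow> fst e \<in> set (scanned S) \<union> queue S \<and>
     node_dist S (fst e) \<le> node_dist S (snd e) + w e"

definition invariant :: "'a search_state \<Rightarrow> bool" where
  "invariant S \<longleftrightarrow>
     consistent S \<and> (\<forall>e\<in>parcs G. snd e \<in> set (scanned S) \<longrightarrow> relaxed S e)"

lemma scanned_relax [simp]: "scanned (relax w nhat e S) = scanned S"
  by (simp add: relax_def Let_def)

text \<open>If the tail is already scanned, \<open>relax\<close> changes nothing and the inequality
  is the triangle inequality between exact distances.\<close>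

lemma relaxed_relax:
  assumes "consistent S" "e \<in> parcs G" "snd e \<in> set (scanned S)"
  shows "relaxed (relax w nhat e S) e"
proof (cases "fst e \<in> set (scanned S)")
  case True
  have "distance G w (fst e) s \<le> distance G w (snd e) s + ereal (w e)"
    using distance_arc[where w = w, OF w_nonneg, of "fst e" "snd e"] assms(2) by simp
  moreover have "\<forall>x\<in>set (scanned S). distance G w x s = ereal (node_dist S x)"
    using assms(1) by (simp add: consistent_def)
  ultimately have "node_dist S (fst e) \<le> node_dist S (snd e) + w e"
    using True assms(3) by simp
  then show ?thesis using True by (simp add: relaxed_def relax_def Let_def)
next
  case False
  \<comment> \<open>Since \<open>e\<close> is not a loop, the update at its tail leaves the value at
    its head unchanged.\<close>
  then have "fst e \<noteq> snd e" using assms(3) by auto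
  then show ?thesis using False by (auto simp: relaxed_def relax_def Let_def)
qed

text \<open>An update can only lower the value of a queued tail, and the value of a scanned head is
  fixed.\<close>

lemma relaxed_relax_mono:
  assumes "relaxed S e'" "snd e' \<in> set (scanned S)"
  shows "relaxed (relax w nhat e S) e'"
  using assms by (auto simp: relaxed_def relax_def Let_def)

lemma consistent_relax:
  assumes "consistent S" "e \<in> parcs G" "snd e \<in> set (scanned S)"
  shows "consistent (relax w nhat e S)"
proof (cases "fst e \<notin> set (scanned S) \<and>
    (fst e \<notin> queue S \<or> node_dist S (snd e) + w e < node_dist S (fst e))")
  case False
  then have "relax w nhat e S = S" by (auto simp: relax_def Let_def)
  then show ?thesis using assms(1) by simp
next
  case True
  obtain u v where e: "e = (u, v)" by (cases e)
  then have uv: "(u, v) \<in> parcs G" "v \<in> set (scanned S)" "u \<notin> set (scanned S)" "u \<in> pverts G"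
    using assms(2,3) True arc_fst_in_verts by force+
  have S': "relax w nhat e S = S\<lparr> queue := insert u (queue S),
      node_rDr := (node_rDr S)(u := nhat u (node_dist S v + w (u, v))),
      node_dist := (node_dist S)(u := node_dist S v + w (u, v)),
      via := (via S)(u := Some (u, v)) \<rparr>"
    using True e by (simp add: relax_def Let_def)
  \<comment> \<open>All updates happen at the unscanned node \<open>u\<close>, so every clause about
    scanned nodes, in particular about \<open>s\<close>, is unaffected.\<close>
  have neq: "x \<noteq> u" if "x \<in> set (scanned S)" for x using that uv(3) by blast
  show ?thesis
    using assms(1) uv unfolding S' consistent_def by (auto simp: neq)
qed

text \<open>\<open>P\<close> collects the arcs known to be relaxed; it is general so that each
  processed arc can join it in the induction.\<close>

lemma invariant_fold_relax:
  assumes "consistent S" "set es \<subseteq> parcs G" "snd ` set es \<subseteq> set (scanned S)"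
    and "\<And>e. e \<in> P \<Longrightarrow> snd e \<in> set (scanned S) \<and> relaxed S e"
  shows "scanned (fold (relax w nhat) es S) = scanned S \<and>
    consistent (fold (relax w nhat) es S) \<and>
    (\<forall>e\<in>P \<union> set es. relaxed (fold (relax w nhat) es S) e)"
  using assms
proof (induction es arbitrary: S P)
  case Nil
  then show ?case by auto
next
  case (Cons e es)
  have "scanned (fold (relax w nhat) es (relax w nhat e S)) = scanned (relax w nhat e S) \<and>
    consistent (fold (relax w nhat) es (relax w nhat e S)) \<and>
    (\<forall>e'\<in>insert e P \<union> set es. relaxed (fold (relax w nhat) es (relax w nhat e S)) e')"
    using Cons.prems
    by (intro Cons.IH) (auto intro: consistent_relax relaxed_relax relaxed_relax_mono)
  then show ?case by simp
qed

section \<open>Exactness of the extracted values\<close>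

text \<open>The witness is the node just before the first scanned node of the walk: the arc between
  them is relaxed, so it is queued. \<open>nhat_arc\<close> carries the bound on its estimate back
  along the walk to \<open>x\<close>.\<close>

lemma last_unscanned_node:
  assumes "invariant S" "awalk x p s" "x \<notin> set (scanned S)"
  shows "\<exists>u\<in>queue S. node_dist S u \<le> awalk_cost w p \<and>
    nhat u (node_dist S u) \<le> nhat x (awalk_cost w p)"
  using assms(2,3)
proof (induction p arbitrary: x)
  case Nil
  then show ?case using assms(1) by (auto simp: awalk_Nil_iff invariant_def consistent_def)
next
  case (Cons e p)
  then obtain y where e: "e = (x, y)" "(x, y) \<in> parcs G" "awalk y p s"
    by (cases e) (auto simp: awalk_Cons_iff)
  show ?case
  proof (cases "y \<in> set (scanned S)")
    case True
    then have "relaxed S (x, y)" using assms(1) e by (auto simp: invariant_def)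
    then have x: "x \<in> queue S" "node_dist S x \<le> node_dist S y + w (x, y)"
      using Cons.prems by (auto simp: relaxed_def)
    have "ereal (node_dist S y) = distance G w y s"
      using assms(1) True by (simp add: invariant_def consistent_def)
    then have "node_dist S y \<le> awalk_cost w p"
      using min_cost_le_walk_cost[OF e(3), of w] by (metis ereal_less_eq(3))
    then have "node_dist S x \<le> awalk_cost w (e # p)" using x e by simp
    then show ?thesis using x nhat_mono by blast
  next
    case False
    then obtain u where u: "u \<in> queue S" "node_dist S u \<le> awalk_cost w p"
      "nhat u (node_dist S u) \<le> nhat y (awalk_cost w p)"
      using Cons.IH e by blast
    have "nhat y (awalk_cost w p) \<le> nhat x (awalk_cost w (e # p))"
      using nhat_arc[OF e(2), of "awalk_cost w p"] e by (simp add: add.commute)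
    then show ?thesis using u w_pos[OF e(2)] e by (intro bexI[of _ u]) auto
  qed
qed

text \<open>The recorded value is an exact distance at a scanned node plus one arc length, so it
  cannot undercut the distance.\<close>

lemma consistent_node_dist_ge:
  assumes "consistent S" "v \<in> set (scanned S) \<union> queue S"
  shows "distance G w v s \<le> ereal (node_dist S v)"
proof (cases "v = s")
  case True
  then show ?thesis using assms distance_self[where w = w, OF w_nonneg source] by (simp add: consistent_def)
next
  case False
  then obtain x where x: "x \<in> set (scanned S)" "(v, x) \<in> parcs G"
    "node_dist S v = node_dist S x + w (v, x)"
    using assms by (auto simp: consistent_def)
  then have "distance G w x s = ereal (node_dist S x)"
    using assms(1) by (simp add: consistent_def)
  then show ?thesis using distance_arc[where w = w, OF w_nonneg x(2), of s] x by simp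
qed

lemma extracted_node_dist:
  assumes inv: "invariant S" and it: "iteration G w nhat v S S'"
  shows "ereal (node_dist S v) = distance G w v s"
proof (rule antisym)
  have v: "v \<in> queue S" "\<And>u. u \<in> queue S \<Longrightarrow> \<not> precedes S u v"
    using it by (auto simp: iteration_def)
  have con: "consistent S" using inv by (simp add: invariant_def)
  show "distance G w v s \<le> ereal (node_dist S v)"
    using consistent_node_dist_ge[OF con] v(1) by blast
  have "node_dist S v \<le> awalk_cost w p" if p: "awalk v p s" for p
  proof (rule ccontr)
    assume less: "\<not> node_dist S v \<le> awalk_cost w p"
    have "v \<notin> set (scanned S)" using con v(1) by (auto simp: consistent_def)
    then obtain u where u: "u \<in> queue S" "node_dist S u \<le> awalk_cost w p"
      "nhat u (node_dist S u) \<le> nhat v (awalk_cost w p)"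
      using last_unscanned_node[OF inv p] by blast
    have "nhat v (awalk_cost w p) \<le> nhat v (node_dist S v)"
      using less by (intro nhat_mono) simp
    moreover have "\<forall>u\<in>queue S. node_rDr S u = nhat u (node_dist S u)"
      using con by (simp add: consistent_def)
    ultimately have "node_rDr S u \<le> node_rDr S v" using u v(1) by simp
    \<comment> \<open>The estimates may tie, so strictness comes from the second component:
      \<open>node_dist S u \<le> awalk_cost w p < node_dist S v\<close>.\<close>
    then have "precedes S u v" using u less by (auto simp: precedes_def)
    then show False using v(2) u(1) by blast
  qed
  then show "ereal (node_dist S v) \<le> distance G w v s"
    unfolding \<mu>_def by (intro INF_greatest) auto
qed

section \<open>Preservation by iterations, termination and coverage\<close>

lemma iteration_initial_state:
  assumes "iteration G w nhat v (initial_state s) S'"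
  shows "v = s"
  using assms by (simp add: iteration_def initial_state_def)

lemma invariant_iteration:
  assumes "invariant S \<or> S = initial_state s" and it: "iteration G w nhat v S S'"
  shows "invariant S' \<and> scanned S' = scanned S @ [v]"
proof -
  \<comment> \<open>The intermediate state after the extraction: already consistent, although arcs
    into \<open>v\<close> may not be relaxed yet.\<close>
  define S0 where "S0 = S\<lparr> queue := queue S - {v}, scanned := scanned S @ [v] \<rparr>"
  obtain es where es: "set es = in_arcs G v" "S' = fold (relax w nhat) es S0"
    using it by (auto simp: iteration_def S0_def)
  have v: "v \<in> queue S" using it by (simp add: iteration_def)
  have S0: "consistent S0 \<and>
    (\<forall>e\<in>parcs G. snd e \<in> set (scanned S) \<longrightarrow> relaxed S0 e)"
    using assms(1)
  proof
    assume inv: "invariant S"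
    have "ereal (node_dist S v) = distance G w v s" by (rule extracted_node_dist[OF inv it])
    moreover have con: "consistent S" using inv by (simp add: invariant_def)
    \<comment> \<open>Recorded successors stay valid because the scanned set only grows.\<close>
    have "set (scanned S) \<subseteq> set (scanned S0)" by (auto simp: S0_def)
    then have "\<forall>u\<in>set (scanned S) \<union> queue S. u \<noteq> s \<longrightarrow>
        (\<exists>x\<in>set (scanned S0). (u, x) \<in> parcs G \<and> via S u = Some (u, x) \<and>
           node_dist S u = node_dist S x + w (u, x))"
      using con unfolding consistent_def by (meson subsetD)
    moreover have "set (scanned S0) \<union> queue S0 = set (scanned S) \<union> queue S"
      using v by (auto simp: S0_def)
    ultimately have "consistent S0"
      using con v unfolding consistent_def by (auto simp: S0_def)
    moreover have "relaxed S0 e" if "e \<in> parcs G" "snd e \<in> set (scanned S)" for e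
      using that inv by (auto simp: invariant_def relaxed_def S0_def)
    ultimately show ?thesis by blast
  next
    assume S: "S = initial_state s"
    have [simp]: "v = s" using iteration_initial_state it S by blast
    show ?thesis
      using source distance_self[where w = w, OF w_nonneg source]
      by (simp add: S S0_def consistent_def initial_state_def zero_ereal_def)
  qed
  \<comment> \<open>Together with the arcs into \<open>v\<close>, these are all arcs into nodes
    scanned in \<open>S'\<close>.\<close>
  define P where "P = {e\<in>parcs G. snd e \<in> set (scanned S)}"
  have "scanned S' = scanned S0 \<and> consistent S' \<and> (\<forall>e\<in>P \<union> set es. relaxed S' e)"
    unfolding es(2) using S0 es(1)
    by (intro invariant_fold_relax) (auto simp: P_def S0_def in_arcs_def)
  then show ?thesis
    using es(1) by (auto simp: invariant_def P_def S0_def in_arcs_def)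
qed

lemma run_invariant:
  assumes "run G w nhat s f"
  shows "invariant (f i) \<or> f i = initial_state s"
proof (induction i)
  case 0
  then show ?case using assms by (simp add: run_def)
next
  case (Suc i)
  then show ?case
    using assms invariant_iteration[of "f i" _ "f (Suc i)"] unfolding run_def by metis
qed

text \<open>Each iteration scans a new node of the finite graph, so after more iterations than nodes
  the list \<open>scanned\<close> would be too long.\<close>

lemma run_terminates:
  assumes "run G w nhat s f"
  obtains n where "queue (f n) = {}" "invariant (f n)"
proof -
  have "\<exists>n. queue (f n) = {}"
  proof (rule ccontr)
    assume "\<nexists>n. queue (f n) = {}"
    then have it: "\<exists>v. iteration G w nhat v (f i) (f (Suc i))" for i
      using assms unfolding run_def by metis
    have len: "length (scanned (f i)) = i" for i
    proof (induction i)
      case 0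
      then show ?case using assms by (simp add: run_def initial_state_def)
    next
      case (Suc i)
      then show ?case
        using it[of i] invariant_iteration[OF run_invariant[OF assms]] by fastforce
    qed
    let ?n = "Suc (card (pverts G))"
    have "f ?n \<noteq> initial_state s" using len[of ?n] by (auto simp: initial_state_def)
    then have "consistent (f ?n)" using run_invariant[OF assms, of ?n] by (simp add: invariant_def)
    then have "distinct (scanned (f ?n))" "set (scanned (f ?n)) \<subseteq> pverts G"
      by (auto simp: consistent_def)
    then have "?n \<le> card (pverts G)"
      using len[of ?n] distinct_card card_mono[OF pair_finite_verts] by metis
    then show False by simp
  qed
  then obtain n where n: "queue (f n) = {}" by blast
  then have "f n \<noteq> initial_state s" by (auto simp: initial_state_def)
  then show ?thesis using that n run_invariant[OF assms] by blast
qed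

text \<open>With an empty queue, a relaxed arc into a scanned node has a scanned tail, so
  scannedness spreads backwards from \<open>s\<close>.\<close>

lemma reaching_nodes_scanned:
  assumes "invariant S" "queue S = {}" "v \<rightarrow>\<^sup>*\<^bsub>with_proj G\<^esub> s"
  shows "v \<in> set (scanned S)"
  using assms(3)
proof (induction rule: converse_reachable_induct)
  case base
  then show ?case using assms(1) by (simp add: invariant_def consistent_def)
next
  case (step u v)
  then show ?case using assms(1,2) by (fastforce simp: invariant_def relaxed_def)
qed

section \<open>The search tree and its walks\<close>

text \<open>The recorded edge of a scanned node starts at that node, so each node has at most one
  outgoing tree arc.\<close>

lemma search_tree_arc:
  assumes "consistent S"
  shows "(u, x) \<in> parcs (search_tree S) \<longleftrightarrow> u \<in> set (scanned S) \<and> via S u = Some (u, x)"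
proof -
  have "\<exists>x. via S v = Some (v, x)" if "v \<in> set (scanned S)" "via S v = Some e" for v e
    using assms that unfolding consistent_def by (metis UnI1 option.distinct(1))
  then show ?thesis by (fastforce simp: search_tree_def)
qed

lemma search_tree_arcD:
  assumes "consistent S" "(u, x) \<in> parcs (search_tree S)"
  shows "u \<noteq> s" "x \<in> set (scanned S)" "(u, x) \<in> parcs G"
    "node_dist S u = node_dist S x + w (u, x)"
proof -
  have u: "u \<in> set (scanned S)" "via S u = Some (u, x)"
    using assms search_tree_arc by blast+
  then show "u \<noteq> s" using assms(1) by (auto simp: consistent_def)
  then obtain x' where "x' \<in> set (scanned S)" "(u, x') \<in> parcs G" "via S u = Some (u, x')"
    "node_dist S u = node_dist S x' + w (u, x')"
    using u(1) assms(1) by (auto simp: consistent_def)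
  then show "x \<in> set (scanned S)" "(u, x) \<in> parcs G" "node_dist S u = node_dist S x + w (u, x)"
    using u(2) by auto
qed

lemma pverts_search_tree [simp]: "pverts (search_tree S) = set (scanned S)"
  by (simp add: search_tree_def)

lemma search_tree_wf: "consistent S \<Longrightarrow> pair_wf_digraph (search_tree S)"
  by unfold_locales (auto simp: search_tree_arc dest: search_tree_arcD)

text \<open>Along a tree arc \<open>node_dist\<close> drops by exactly the arc length, and it
  vanishes at \<open>s\<close>, so the cost telescopes.\<close>

lemma search_tree_awalk_cost:
  assumes "consistent S" "pre_digraph.awalk (with_proj (search_tree S)) v p s"
  shows "awalk_cost w p = node_dist S v"
proof -
  interpret T: pair_wf_digraph "search_tree S" by (rule search_tree_wf[OF assms(1)])
  show ?thesis using assms(2)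
  proof (induction p arbitrary: v)
    case Nil
    then show ?case using assms(1) by (auto simp: T.awalk_Nil_iff consistent_def)
  next
    case (Cons e p)
    then obtain x where "e = (v, x)" "(v, x) \<in> parcs (search_tree S)" "T.awalk x p s"
      by (cases e) (auto simp: T.awalk_Cons_iff)
    then show ?case using Cons.IH search_tree_arcD[OF assms(1)] by auto
  qed
qed

text \<open>At most one tree arc leaves each node and none leaves \<open>s\<close>, so a walk to
  \<open>s\<close> is forced at every step and must stop there.\<close>

lemma search_tree_awalk_unique:
  assumes "consistent S" "pre_digraph.awalk (with_proj (search_tree S)) v p s"
    "pre_digraph.awalk (with_proj (search_tree S)) v q s"
  shows "p = q"
proof -
  interpret T: pair_wf_digraph "search_tree S" by (rule search_tree_wf[OF assms(1)])
  show ?thesis using assms(2,3)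
  proof (induction p arbitrary: v q)
    case Nil
    then show ?case
      using search_tree_arcD(1)[OF assms(1)] by (cases q) (force simp: T.awalk_simps)+
  next
    case (Cons e p)
    then obtain x where e: "e = (v, x)" "(v, x) \<in> parcs (search_tree S)" "T.awalk x p s"
      by (cases e) (auto simp: T.awalk_Cons_iff)
    then have "v \<noteq> s" using search_tree_arcD(1)[OF assms(1)] by blast
    then obtain y q' where q: "q = (v, y) # q'" "(v, y) \<in> parcs (search_tree S)" "T.awalk y q' s"
      using Cons.prems(2) by (cases q) (auto simp: T.awalk_simps)
    then have "x = y" using e search_tree_arc[OF assms(1)] by auto
    then show ?case using Cons.IH e q by auto
  qed
qed

lemma search_tree_awalk_exists:
  assumes "consistent S" "v \<in> set (scanned S)"
  shows "\<exists>p. pre_digraph.awalk (with_proj (search_tree S)) v p s"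
proof -
  interpret T: pair_wf_digraph "search_tree S" by (rule search_tree_wf[OF assms(1)])
  show ?thesis using assms(2)
  \<comment> \<open>Arcs have positive length, so \<open>node_dist\<close> decreases along \<open>via\<close>.\<close>
  proof (induction "card {u\<in>set (scanned S). node_dist S u < node_dist S v}"
      arbitrary: v rule: less_induct)
    case less
    show ?case
    proof (cases "v = s")
      case True
      then have "T.awalk v [] s" using less.prems by (simp add: T.awalk_Nil_iff)
      then show ?thesis ..
    next
      case False
      then obtain x where x: "x \<in> set (scanned S)" "(v, x) \<in> parcs G" "via S v = Some (v, x)"
        "node_dist S v = node_dist S x + w (v, x)"
        using less.prems assms(1) by (auto simp: consistent_def)
      then have lt: "node_dist S x < node_dist S v" using w_pos[OF x(2)] by simp
      then have "{u\<in>set (scanned S). node_dist S u < node_dist S x}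
          \<subset> {u\<in>set (scanned S). node_dist S u < node_dist S v}"
        using x(1) by auto
      then have "card {u\<in>set (scanned S). node_dist S u < node_dist S x}
          < card {u\<in>set (scanned S). node_dist S u < node_dist S v}"
        by (intro psubset_card_mono) auto
      then obtain p where "T.awalk x p s" using less.hyps x(1) by blast
      moreover have "(v, x) \<in> parcs (search_tree S)"
        using search_tree_arc[OF assms(1)] less.prems x(3) by blast
      ultimately have "T.awalk v ((v, x) # p) s" by (simp add: T.awalk_Cons_iff)
      then show ?thesis ..
    qed
  qed
qed

lemma search_tree_awalk_distance:
  assumes "consistent S" "v \<in> set (scanned S)"
    "pre_digraph.awalk (with_proj (search_tree S)) v p s"
  shows "ereal (awalk_cost w p) = distance G w v s"
  using search_tree_awalk_cost[OF assms(1,3)] assms(1,2) by (simp add: consistent_def)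

lemma reverse_search_tree_shortest_paths:
  assumes "consistent S"
  shows "shortest_paths_tree (reverse_arcs G) (reverse_lengths w) s (reverse_arcs (search_tree S))"
proof -
  interpret T: pair_wf_digraph "search_tree S" by (rule search_tree_wf[OF assms])
  have "set (scanned S) \<subseteq> pverts G" "s \<in> set (scanned S)"
    using assms by (auto simp: consistent_def)
  moreover have "parcs (search_tree S) \<subseteq> parcs G"
    using search_tree_arcD(3)[OF assms] by auto
  moreover have "wf_digraph (reverse_arcs G)" "wf_digraph (reverse_arcs (search_tree S))"
    by (simp_all add: wf_digraph_wp_iff reverse_arcs_wf T.reverse_arcs_wf)
  ultimately have "subgraph (reverse_arcs (search_tree S)) (reverse_arcs G)"
    by (auto simp: subgraph_def compatible_def)
  moreover have "\<exists>!p. pre_digraph.awalk (reverse_arcs (search_tree S)) s p v"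
    if v: "v \<in> set (scanned S)" for v
  proof -
    obtain p where "T.awalk v p s" using search_tree_awalk_exists[OF assms v] by blast
    \<comment> \<open>\<open>rev_path\<close> is an involution, so existence and uniqueness carry
      over from walks towards \<open>s\<close> to walks away from \<open>s\<close>.\<close>
    then show ?thesis
      using search_tree_awalk_unique[OF assms]
      unfolding T.awalk_reverse_arcs_iff by (metis rev_path_rev_path)
  qed
  moreover have "ereal (awalk_cost (reverse_lengths w) p) =
      distance (reverse_arcs G) (reverse_lengths w) s v"
    if "v \<in> set (scanned S)" "pre_digraph.awalk (reverse_arcs (search_tree S)) s p v" for v p
    using search_tree_awalk_distance[OF assms that(1), of "rev_path p"] that(2)
      awalk_cost_reverse_lengths[of w "rev_path p"]
    by (simp add: T.awalk_reverse_arcs_iff distance_reverse_arcs)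
  ultimately show ?thesis
    using \<open>s \<in> set (scanned S)\<close> by (simp add: shortest_paths_tree_def)
qed

end

theorem theorem4p1:
  fixes G :: "'a pair_pre_digraph" and w :: "'a \<times> 'a \<Rightarrow> real" and U :: "'a set" and s :: 'a
    and nhat :: "'a \<Rightarrow> real \<Rightarrow> real" and f :: "nat \<Rightarrow> 'a search_state"
  assumes "directed_network G w \<or> undirected_network G w"
    and "U \<subseteq> pverts G" and "s \<in> pverts G"
    and "nhat = exact_count G w U \<or>
         (\<exists>k r. 1 \<le> k \<and> inj_on r U \<and> r ` U \<subseteq> {0<..1} \<and> nhat = bottom_k_estimate G w U k r)"
    and "run G w nhat s f"
  shows "(\<forall>i v. iteration G w nhat v (f i) (f (Suc i)) \<longrightarrow>
            ereal (node_dist (f i) v) = distance G w v s) \<and>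
         (\<exists>n. queue (f n) = {} \<and>
            shortest_paths_tree (reverse_arcs G) (reverse_lengths w) s
              (reverse_arcs (search_tree (f n))) \<and>
            (\<forall>v\<in>pverts (search_tree (f n)). \<exists>p.
               pre_digraph.awalk (with_proj (search_tree (f n))) v p s \<and>
               ereal (wf_digraph.awalk_cost w p) = distance G w v s) \<and>
            {v. v \<rightarrow>\<^sup>*\<^bsub>with_proj G\<^esub> s} \<subseteq> pverts (search_tree (f n)))"
proof -
  interpret pair_fin_digraph G
    using assms(1) pair_pseudo_graph.axioms(1)
    by (auto simp: directed_network_def undirected_network_def)
  have w: "0 < w e" if "e \<in> parcs G" for e
    using assms(1) that by (auto simp: directed_network_def undirected_network_def)
  have finU: "finite U" using assms(2) pair_finite_verts by (rule finite_subset)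
  \<comment> \<open>Both admissible estimates enter the rest of the proof only through this
    monotonicity in the counted set.\<close>
  have mono: "nhat u y \<le> nhat v z"
    if "neighborhood G w U u y \<subseteq> neighborhood G w U v z" for u v y z
    using assms(4) that finU exact_count_mono bottom_k_estimate_mono by metis
  interpret monotone_search G w nhat s
  proof
    show "nhat v d \<le> nhat v d'" if "d \<le> d'" for v d d'
      using neighborhood_mono[OF that] by (rule mono)
    show "nhat v d \<le> nhat u (d + w (u, v))" if "(u, v) \<in> parcs G" for u v d
      using w that by (intro mono neighborhood_arc) (auto intro: less_imp_le)
  qed (use w assms(3) in auto)
  have "ereal (node_dist (f i) v) = distance G w v s"
    if it: "iteration G w nhat v (f i) (f (Suc i))" for i v
    using run_invariant[OF assms(5), of i]
  proof
    \<comment> \<open>The first extraction precedes the invariant; it returns \<open>s\<close> with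
      value 0.\<close>
    assume "f i = initial_state s"
    moreover from this it have "v = s" by (metis iteration_initial_state)
    ultimately show ?thesis
      using distance_self[where w = w, OF w_nonneg source] by (simp add: initial_state_def)
  qed (use it extracted_node_dist in blast)
  moreover obtain n where n: "queue (f n) = {}" "invariant (f n)"
    using run_terminates[OF assms(5)] .
  then have "consistent (f n)" by (simp add: invariant_def)
  then have "shortest_paths_tree (reverse_arcs G) (reverse_lengths w) s
        (reverse_arcs (search_tree (f n)))"
    and "\<forall>v\<in>pverts (search_tree (f n)). \<exists>p.
        pre_digraph.awalk (search_tree (f n)) v p s \<and> ereal (awalk_cost w p) = distance G w v s"
    using reverse_search_tree_shortest_paths search_tree_awalk_exists
      search_tree_awalk_distance unfolding pverts_search_tree by blast+
  moreover have "{v. v \<rightarrow>\<^sup>*\<^bsub>with_proj G\<^esub> s} \<subseteq> pverts (search_tree (f n))"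
    using reaching_nodes_scanned[OF n(2,1)] by auto
  ultimately show ?thesis using n(1) by blast
qed

end
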